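(* Let $K>0$, $q\ne0$, $r_w>0$ and $\Delta>0$ be given constants. For $r_e>r_w$ let $|U|=\pi(r_e^2-r_w^2)$, let $w$ be the radial function, given for $r>0$ by its explicit formula, with $$\frac{K}{r}\left(r\,w'(r)\right)'=\frac{q}{|U|},\qquad w(r_w)=0,\qquad w'(r_e)=0,$$ and let $p_{pss}(r,t)=w(r)+\frac{q}{|U|}t$. Then there exists a solution of the Peaceman problem for the time-dependent PSS regime of production, i.e. a time-independent number $R_0^{PSS}(r_e,\Delta)$ such that $p_0(s)=p_{pss}(R_0^{PSS}(r_e,\Delta),s)$ and $p_1(s)=p_{pss}(\Delta,s)$ satisfy, for all $s$ and all $\tau>0$, $$-4K\left(p_0(s)-p_1(s)\right)+q=\Delta^2\,\frac{1}{\tau}\left(p_0(s+\tau)-p_0(s)\right),$$ and the corresponding $R_0^{PSS}(r_e,\Delta)$ is defined by the equation $$-\pi+\frac{\left[R_0^{PSS}(r_e,\Delta)\right]^2}{r_e^2}+\pi\frac{r_w^2}{r_e^2}=-2\ln\frac{\Delta}{R_0^{PSS}(r_e,\Delta)}.$$ Moreover, $$\lim_{r_e\to\infty}R_0^{PSS}(r_e,\Delta)=R_0^{SS}=R_{Peaceman},$$ where $R_{Peaceman}=e^{-\pi/2}\Delta$.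
   Context: PSS means pseudo-steady state. The flow takes place in the annulus $U=\{x\in\mathbb{R}^2:r_w<|x|<r_e\}$ of height $h=1$, with well boundary $|x|=r_w$, constant rate $q$, no flow through $|x|=r_e$, and porosity times compressibility normalised to $1$. The radial profile $w$ is used through its explicit formula $w(r)=\frac{q}{K|U|}\left[\frac{r^2-r_w^2}{4}-\frac{r_e^2}{2}\ln\frac{r}{r_w}\right]$. The block containing the well has dimensions $\Delta\times\Delta\times1$; $p_0$ is the pressure in that block and $p_1$ the pressure in the neighbouring blocks. The Peaceman radius is understood under the condition of applicability of these formulae, $R_0^{PSS}(r_e,\Delta)\le r_e$. The classical steady-state Peaceman radius $R_0^{SS}=R_{Peaceman}$ on a square grid is given by $\ln\frac{\Delta}{R_0}=\frac{\pi}{2}$.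
   Formalization: Existence of R_0^PSS is proved (with uniqueness in (0, r_e]) only when -π+1+π r_w²/r_e² ≤ -2 ln(Δ/r_e), which is necessary for any root and holds for all large r_e; for e.g. Δ=100 r_e the equation has no positive solution. *)

theory Defs imports "HOL-Analysis.Analysis" begin

definition annulus_area :: "real \<Rightarrow> real \<Rightarrow> real" where
  "annulus_area rw re = pi * (re\<^sup>2 - rw\<^sup>2)"

definition pss_profile_problem ::
    "real \<Rightarrow> real \<Rightarrow> real \<Rightarrow> real \<Rightarrow> (real \<Rightarrow> real) \<Rightarrow> bool" where
  "pss_profile_problem K q rw re w \<longleftrightarrow>
     (\<forall>r>0. w differentiable (at r) \<and> (\<lambda>x. x * deriv w x) differentiable (at r) \<and>
        K / r * deriv (\<lambda>x. x * deriv w x) r = q / annulus_area rw re) \<and>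
     w rw = 0 \<and> deriv w re = 0"

definition pss_profile :: "real \<Rightarrow> real \<Rightarrow> real \<Rightarrow> real \<Rightarrow> real \<Rightarrow> real" where
  "pss_profile K q rw re r =
     q / (K * annulus_area rw re) * ((r\<^sup>2 - rw\<^sup>2) / 4 - re\<^sup>2 / 2 * ln (r / rw))"

definition pss_pressure :: "real \<Rightarrow> real \<Rightarrow> real \<Rightarrow> real \<Rightarrow> real \<Rightarrow> real \<Rightarrow> real" where
  "pss_pressure K q rw re r t = pss_profile K q rw re r + q / annulus_area rw re * t"

text \<open>Discrete material balance on the well block, with the same \<open>R\<close> for all
  times \<open>s\<close> and time steps \<open>\<tau>\<close>.\<close>

definition peaceman_PSS_solution ::
    "real \<Rightarrow> real \<Rightarrow> real \<Rightarrow> real \<Rightarrow> real \<Rightarrow> real \<Rightarrow> bool" where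
  "peaceman_PSS_solution K q rw re \<Delta> R \<longleftrightarrow>
     R > 0 \<and>
     (let p0 = (\<lambda>s. pss_pressure K q rw re R s);
          p1 = (\<lambda>s. pss_pressure K q rw re \<Delta> s)
      in \<forall>s. \<forall>\<tau>>0. - 4 * K * (p0 s - p1 s) + q = \<Delta>\<^sup>2 * (1 / \<tau>) * (p0 (s + \<tau>) - p0 s))"

definition peaceman_PSS_equation :: "real \<Rightarrow> real \<Rightarrow> real \<Rightarrow> real \<Rightarrow> bool" where
  "peaceman_PSS_equation rw re \<Delta> R \<longleftrightarrow>
     - pi + R\<^sup>2 / re\<^sup>2 + pi * (rw\<^sup>2 / re\<^sup>2) = - 2 * ln (\<Delta> / R)"

text \<open>The equation generally has a second root above \<open>re\<close>, which tends to infinity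
  with \<open>re\<close>. The condition of applicability \<open>R \<le> re\<close> excludes it.\<close>

definition is_peaceman_radius_PSS ::
    "real \<Rightarrow> real \<Rightarrow> real \<Rightarrow> real \<Rightarrow> real \<Rightarrow> real \<Rightarrow> bool" where
  "is_peaceman_radius_PSS K q rw re \<Delta> R \<longleftrightarrow>
     peaceman_PSS_solution K q rw re \<Delta> R \<and> R \<le> re"

definition peaceman_radius_PSS :: "real \<Rightarrow> real \<Rightarrow> real \<Rightarrow> real \<Rightarrow> real \<Rightarrow> real" where
  "peaceman_radius_PSS K q rw re \<Delta> = (THE R. is_peaceman_radius_PSS K q rw re \<Delta> R)"

definition is_peaceman_radius_SS :: "real \<Rightarrow> real \<Rightarrow> bool" where
  "is_peaceman_radius_SS \<Delta> R \<longleftrightarrow> R > 0 \<and> ln (\<Delta> / R) = pi / 2"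

definition peaceman_radius_SS :: "real \<Rightarrow> real" where
  "peaceman_radius_SS \<Delta> = (THE R. is_peaceman_radius_SS \<Delta> R)"

text \<open>A block size \<open>\<Delta>\<close> large compared with \<open>re\<close> leaves the equation
  without roots. The condition below says that its right-hand side minus its left-hand
  side, which as a function of \<open>R > 0\<close> is maximal at \<open>R = re\<close>, is nonnegative there.\<close>

definition peaceman_PSS_applicable :: "real \<Rightarrow> real \<Rightarrow> real \<Rightarrow> bool" where
  "peaceman_PSS_applicable rw re \<Delta> \<longleftrightarrow>
     - pi + re\<^sup>2 / re\<^sup>2 + pi * (rw\<^sup>2 / re\<^sup>2) \<le> - 2 * ln (\<Delta> / re)"

lemma peaceman_PSS_equation_imp_applicable:
  assumes "re > 0" "\<Delta> > 0" "R > 0" "peaceman_PSS_equation rw re \<Delta> R"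
  shows "peaceman_PSS_applicable rw re \<Delta>"
proof -
  have "ln (R\<^sup>2 / re\<^sup>2) \<le> R\<^sup>2 / re\<^sup>2 - 1"
    using assms by (intro ln_le_minus_one) simp
  moreover have "ln (R\<^sup>2 / re\<^sup>2) = 2 * ln R - 2 * ln re"
    using assms by (simp add: ln_div ln_realpow)
  ultimately show ?thesis
    using assms unfolding peaceman_PSS_equation_def peaceman_PSS_applicable_def
    by (simp add: ln_div)
qed

end

theory Submission imports Defs begin

text \<open>
  The factor \<open>q / annulus_area rw re\<close> is common to the profile and to the rate of pressure
  growth. Dividing the material balance of the well block by it cancels the term
  \<open>\<Delta>\<^sup>2\<close> on both sides: the quadratic part of the profile at distance \<open>\<Delta>\<close> is exactly the
  accumulation in a \<open>\<Delta> \<times> \<Delta>\<close> block. Neither \<open>s\<close> nor \<open>\<tau>\<close> survives, which is why the radius is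
  independent of time, and the remaining relation is the stated transcendental equation
  (\<open>peaceman_PSS_solution_iff_equation\<close>).

  That equation prescribes the value of \<open>2 ln R - R\<^sup>2 / re\<^sup>2\<close>. This function of \<open>R\<close> increases
  strictly on \<open>(0, re]\<close> (\<open>ln_minus_quadratic_strict_mono\<close>), so there is at most one root below
  \<open>re\<close>. Dropping the quadratic term gives an explicit point at which the function lies below the
  prescribed value, applicability says that at \<open>re\<close> it lies above, and the intermediate value
  theorem yields a root (\<open>ex_peaceman_PSS_root\<close>).

  For the limit the equation is read as a fixed point identity
  \<open>R = \<Delta> exp ((- pi + pi rw\<^sup>2 / re\<^sup>2 + R\<^sup>2 / re\<^sup>2) / 2)\<close>. The condition \<open>R \<le> re\<close> bounds the last
  term by \<open>1\<close>, hence bounds \<open>R\<close> uniformly in \<open>re\<close>; then \<open>R\<^sup>2 / re\<^sup>2\<close> tends to \<open>0\<close>, and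
  the identity forces \<open>R\<close> to tend to \<open>\<Delta> exp (- pi / 2)\<close>.
\<close>

section \<open>The radial pressure profile\<close>

lemma annulus_area_pos: "0 < rw \<Longrightarrow> rw < re \<Longrightarrow> annulus_area rw re > 0"
  by (simp add: annulus_area_def power_strict_mono)

lemma pss_profile_has_real_derivative:
  assumes "rw > 0" "r > 0"
  shows "(pss_profile K q rw re has_real_derivative
           q / (K * annulus_area rw re) * (r / 2 - re\<^sup>2 / (2 * r))) (at r)"
proof -
  define c where "c = q / (K * annulus_area rw re)"
  have "((\<lambda>r. c * ((r\<^sup>2 - rw\<^sup>2) / 4 - re\<^sup>2 / 2 * ln (r / rw))) has_real_derivative
           c * (r / 2 - re\<^sup>2 / (2 * r))) (at r)"
    using assms by (auto intro!: derivative_eq_intros simp: field_simps)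
  moreover have "pss_profile K q rw re = (\<lambda>r. c * ((r\<^sup>2 - rw\<^sup>2) / 4 - re\<^sup>2 / 2 * ln (r / rw)))"
    by (simp add: fun_eq_iff pss_profile_def c_def)
  ultimately show ?thesis
    by (simp add: c_def)
qed

lemma pss_profile_solves_problem:
  assumes "K > 0" "rw > 0" "re > rw"
  shows "pss_profile_problem K q rw re (pss_profile K q rw re)"
proof -
  define w where "w = pss_profile K q rw re"
  define c where "c = q / (K * annulus_area rw re)"
  have w': "(w has_real_derivative c * (r / 2 - re\<^sup>2 / (2 * r))) (at r)" if "r > 0" for r
    unfolding w_def c_def using pss_profile_has_real_derivative[OF \<open>rw > 0\<close> that] .
  have flux: "r * deriv w r = c * (r\<^sup>2 - re\<^sup>2) / 2" if "r > 0" for r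
    using DERIV_imp_deriv[OF w'[OF that]] that by (simp add: field_simps power2_eq_square)
  have flux': "((\<lambda>x. x * deriv w x) has_real_derivative c * r) (at r)" if "r > 0" for r
  proof -
    have "((\<lambda>x. c * (x\<^sup>2 - re\<^sup>2) / 2) has_real_derivative c * r) (at r)"
      by (auto intro!: derivative_eq_intros)
    moreover have "open {0::real<..}" "r \<in> {0<..}"
      using that by auto
    \<comment> \<open>The closed form of the flux holds for positive radii only, so the derivative is
      transferred along this open set.\<close>
    ultimately show ?thesis
      by (rule has_field_derivative_transform_within_open) (simp add: flux)
  qed
  have "K / r * deriv (\<lambda>x. x * deriv w x) r = q / annulus_area rw re" if "r > 0" for r
    using DERIV_imp_deriv[OF flux'[OF that]] that \<open>K > 0\<close> by (simp add: c_def)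
  moreover have "w rw = 0"
    using \<open>rw > 0\<close> by (simp add: w_def pss_profile_def)
  moreover have "deriv w re = 0"
    using flux[of re] assms by simp
  ultimately show ?thesis
    using w' flux' unfolding pss_profile_problem_def w_def[symmetric]
    by (meson real_differentiable_def)
qed

section \<open>Material balance of the well block\<close>

lemma peaceman_PSS_equation_iff_ln:
  assumes "\<Delta> > 0" "R > 0"
  shows "peaceman_PSS_equation rw re \<Delta> R \<longleftrightarrow>
           2 * ln R - R\<^sup>2 / re\<^sup>2 = 2 * ln \<Delta> - pi + pi * (rw\<^sup>2 / re\<^sup>2)"
  using assms by (auto simp: peaceman_PSS_equation_def ln_div)

lemma peaceman_PSS_solution_iff_equation:
  assumes "K > 0" "q \<noteq> 0" "rw > 0" "\<Delta> > 0" "re > rw" "R > 0"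
  shows "peaceman_PSS_solution K q rw re \<Delta> R \<longleftrightarrow> peaceman_PSS_equation rw re \<Delta> R"
proof -
  define A where "A = annulus_area rw re"
  define E where "E = 2 * ln R - R\<^sup>2 / re\<^sup>2 - (2 * ln \<Delta> - pi + pi * (rw\<^sup>2 / re\<^sup>2))"
  have A: "A > 0" "A = pi * (re\<^sup>2 - rw\<^sup>2)" and re: "re > 0"
    using annulus_area_pos assms by (auto simp: A_def annulus_area_def)
  have jump: "pss_profile K q rw re R - pss_profile K q rw re \<Delta> =
      q / (K * A) * ((R\<^sup>2 - \<Delta>\<^sup>2) / 4 - re\<^sup>2 / 2 * (ln R - ln \<Delta>))"
    using assms by (simp add: pss_profile_def A_def[symmetric] ln_div algebra_simps diff_divide_distrib)
  \<comment> \<open>The accumulation \<open>\<Delta>\<^sup>2 q / A\<close> cancels, leaving a multiple of the defect \<open>E\<close>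
    of the equation in logarithmic form.\<close>
  have "- 4 * K * (pss_profile K q rw re R - pss_profile K q rw re \<Delta>) + q - \<Delta>\<^sup>2 * (q / A)
      = q / A * (\<Delta>\<^sup>2 - R\<^sup>2 + 2 * re\<^sup>2 * (ln R - ln \<Delta>) + A - \<Delta>\<^sup>2)"
    unfolding jump using A(1) \<open>K > 0\<close> by (simp add: field_simps)
  also have "\<Delta>\<^sup>2 - R\<^sup>2 + 2 * re\<^sup>2 * (ln R - ln \<Delta>) + A - \<Delta>\<^sup>2 = re\<^sup>2 * E"
    using re by (simp add: E_def A(2) field_simps)
  finally have balance: "- 4 * K * (pss_profile K q rw re R - pss_profile K q rw re \<Delta>) + q
      = \<Delta>\<^sup>2 * (q / A) \<longleftrightarrow> E = 0"
    using A(1) re \<open>q \<noteq> 0\<close> by auto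
  have growth: "\<Delta>\<^sup>2 * (1 / \<tau>) * (q / A * (s + \<tau>) - q / A * s) = \<Delta>\<^sup>2 * (q / A)"
    if "\<tau> > 0" for s \<tau> :: real
    using that A(1) by (simp add: field_simps)
  have "peaceman_PSS_solution K q rw re \<Delta> R \<longleftrightarrow>
      (\<forall>s. \<forall>\<tau>>0. - 4 * K * (pss_profile K q rw re R - pss_profile K q rw re \<Delta>) + q
         = \<Delta>\<^sup>2 * (1 / \<tau>) * (q / A * (s + \<tau>) - q / A * s))"
    using \<open>R > 0\<close> by (simp add: peaceman_PSS_solution_def pss_pressure_def Let_def A_def)
  also have "\<dots> \<longleftrightarrow> E = 0"
    unfolding balance[symmetric] using growth zero_less_one by metis
  finally show ?thesis
    using assms by (simp add: peaceman_PSS_equation_iff_ln E_def)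
qed

section \<open>Existence and uniqueness of the radius\<close>

text \<open>Apply \<open>ln x < x - 1\<close> to \<open>x = a\<^sup>2 / b\<^sup>2\<close>: the logarithm gains more than
  \<open>(b\<^sup>2 - a\<^sup>2) / b\<^sup>2\<close>, and enlarging the denominator to
  \<open>re\<^sup>2\<close> only decreases this quotient.\<close>

lemma ln_minus_quadratic_strict_mono:
  fixes a b re :: real
  assumes "0 < a" "a < b" "b \<le> re"
  shows "2 * ln a - a\<^sup>2 / re\<^sup>2 < 2 * ln b - b\<^sup>2 / re\<^sup>2"
proof -
  have sq: "a\<^sup>2 < b\<^sup>2" "b\<^sup>2 \<le> re\<^sup>2"
    using assms by (auto intro: power_strict_mono power_mono)
  have "(b\<^sup>2 - a\<^sup>2) / re\<^sup>2 \<le> (b\<^sup>2 - a\<^sup>2) / b\<^sup>2"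
    using sq assms by (intro divide_left_mono) auto
  also have "\<dots> = 1 - a\<^sup>2 / b\<^sup>2"
    using assms by (simp add: field_simps)
  also have "\<dots> < - ln (a\<^sup>2 / b\<^sup>2)"
  proof -
    have "a\<^sup>2 / b\<^sup>2 \<noteq> 1" "0 < a\<^sup>2 / b\<^sup>2"
      using sq assms by auto
    then show ?thesis
      using ln_le_minus_one[of "a\<^sup>2 / b\<^sup>2"] ln_eq_minus_one[of "a\<^sup>2 / b\<^sup>2"] by fastforce
  qed
  also have "\<dots> = 2 * ln b - 2 * ln a"
    using assms by (simp add: ln_div ln_realpow)
  finally show ?thesis
    by (simp add: diff_divide_distrib)
qed

lemma peaceman_PSS_root_unique:
  assumes "\<Delta> > 0"
    and "0 < R" "R \<le> re" "peaceman_PSS_equation rw re \<Delta> R"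
    and "0 < S" "S \<le> re" "peaceman_PSS_equation rw re \<Delta> S"
  shows "R = S"
  using assms ln_minus_quadratic_strict_mono[of R S re] ln_minus_quadratic_strict_mono[of S R re]
  by (simp add: peaceman_PSS_equation_iff_ln) (metis less_irrefl linorder_neqE)

lemma ex_peaceman_PSS_root:
  assumes "\<Delta> > 0" "re > 0" "peaceman_PSS_applicable rw re \<Delta>"
  shows "\<exists>R. 0 < R \<and> R \<le> re \<and> peaceman_PSS_equation rw re \<Delta> R"
proof -
  define c where "c = 2 * ln \<Delta> - pi + pi * (rw\<^sup>2 / re\<^sup>2)"
  define f where "f = (\<lambda>R. 2 * ln R - R\<^sup>2 / re\<^sup>2)"
  \<comment> \<open>The root of the equation without its quadratic term.\<close>
  define L where "L = exp (c / 2)"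
  have top: "c \<le> f re"
    using assms by (simp add: c_def f_def peaceman_PSS_applicable_def ln_div)
  have "f re < 2 * ln re"
    using assms by (simp add: f_def)
  with top have "c / 2 \<le> ln re"
    by simp
  then have "L \<le> re"
    using ln_ge_iff[of re "c / 2"] assms by (simp only: L_def)
  moreover have "f L \<le> c"
    by (simp add: f_def L_def)
  moreover have "continuous_on {L..re} f"
  proof -
    have "x \<noteq> 0" if "x \<in> {L..re}" for x
      using that less_le_trans[of 0 L x] by (auto simp: L_def)
    then show ?thesis
      unfolding f_def using assms by (intro continuous_intros) auto
  qed
  ultimately obtain R where R: "L \<le> R" "R \<le> re" "f R = c"
    using IVT'[of f L c re] top by blast
  moreover have "0 < R"
    using R(1) less_le_trans[of 0 L R] by (simp add: L_def)
  ultimately show ?thesis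
    using assms by (auto simp: peaceman_PSS_equation_iff_ln f_def c_def)
qed

lemma ex1_peaceman_radius_PSS:
  assumes "K > 0" "q \<noteq> 0" "rw > 0" "\<Delta> > 0" "re > rw" "peaceman_PSS_applicable rw re \<Delta>"
  shows "\<exists>!R. is_peaceman_radius_PSS K q rw re \<Delta> R"
proof -
  have "is_peaceman_radius_PSS K q rw re \<Delta> R \<longleftrightarrow>
      0 < R \<and> R \<le> re \<and> peaceman_PSS_equation rw re \<Delta> R" for R
    using peaceman_PSS_solution_iff_equation[of K q rw \<Delta> re R] assms
    by (auto simp: is_peaceman_radius_PSS_def peaceman_PSS_solution_def)
  then show ?thesis
    using ex_peaceman_PSS_root[of \<Delta> re rw] peaceman_PSS_root_unique[of \<Delta> _ re rw] assms
    by (metis less_trans)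
qed

lemma peaceman_radius_PSS_satisfies:
  assumes "K > 0" "q \<noteq> 0" "rw > 0" "\<Delta> > 0" "re > rw" "peaceman_PSS_applicable rw re \<Delta>"
  defines "R \<equiv> peaceman_radius_PSS K q rw re \<Delta>"
  shows "is_peaceman_radius_PSS K q rw re \<Delta> R" "0 < R" "R \<le> re"
    "peaceman_PSS_equation rw re \<Delta> R"
proof -
  show *: "is_peaceman_radius_PSS K q rw re \<Delta> R"
    unfolding R_def peaceman_radius_PSS_def
    using ex1_peaceman_radius_PSS[OF assms(1-6)] by (rule theI')
  then show "0 < R" "R \<le> re"
    by (auto simp: is_peaceman_radius_PSS_def peaceman_PSS_solution_def)
  with * show "peaceman_PSS_equation rw re \<Delta> R"
    using peaceman_PSS_solution_iff_equation[of K q rw \<Delta> re R] assms(1-5)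
    by (simp add: is_peaceman_radius_PSS_def)
qed

section \<open>Large drainage radius\<close>

text \<open>The left-hand side of the applicability condition is at most \<open>1\<close>, while its right-hand side
  \<open>2 ln (re / \<Delta>)\<close> is at least \<open>1\<close> from \<open>re = \<Delta> exp (1 / 2)\<close> on.\<close>

lemma eventually_peaceman_PSS_applicable:
  assumes "rw > 0" "\<Delta> > 0"
  shows "\<forall>\<^sub>F re in at_top. peaceman_PSS_applicable rw re \<Delta>"
  using eventually_gt_at_top[of rw] eventually_ge_at_top[of "\<Delta> * exp (1 / 2)"]
proof eventually_elim
  case (elim re)
  have "rw\<^sup>2 / re\<^sup>2 \<le> 1"
    using elim assms by (simp add: power_mono)
  then have "pi * (rw\<^sup>2 / re\<^sup>2) \<le> pi"
    using mult_left_le[of "rw\<^sup>2 / re\<^sup>2" pi] pi_ge_zero by blast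
  moreover have "ln (\<Delta> * exp (1 / 2)) \<le> ln re"
    using elim assms by (subst ln_le_cancel_iff) auto
  ultimately show ?case
    using elim assms by (simp add: peaceman_PSS_applicable_def ln_div ln_mult)
qed

lemma peaceman_PSS_equation_fixed_point:
  assumes "\<Delta> > 0" "R > 0" "peaceman_PSS_equation rw re \<Delta> R"
  shows "R = \<Delta> * exp ((- pi + pi * (rw\<^sup>2 / re\<^sup>2) + R\<^sup>2 / re\<^sup>2) / 2)"
proof -
  have "ln R = ln \<Delta> + (- pi + pi * (rw\<^sup>2 / re\<^sup>2) + R\<^sup>2 / re\<^sup>2) / 2"
    using assms(3) unfolding peaceman_PSS_equation_iff_ln[OF assms(1,2)] by argo
  then have "exp (ln R) = exp (ln \<Delta> + (- pi + pi * (rw\<^sup>2 / re\<^sup>2) + R\<^sup>2 / re\<^sup>2) / 2)"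
    by simp
  then show ?thesis
    using assms by (simp add: exp_add)
qed

lemma peaceman_PSS_root_le:
  assumes "0 < rw" "rw < re" "\<Delta> > 0" "0 < R" "R \<le> re" "peaceman_PSS_equation rw re \<Delta> R"
  shows "R \<le> \<Delta> * exp (1 / 2)"
proof -
  have "rw\<^sup>2 / re\<^sup>2 \<le> 1" "R\<^sup>2 / re\<^sup>2 \<le> 1"
    using assms by (simp_all add: power_mono)
  then have "- pi + pi * (rw\<^sup>2 / re\<^sup>2) + R\<^sup>2 / re\<^sup>2 \<le> 1"
    using pi_gt_zero mult_left_le[of "rw\<^sup>2 / re\<^sup>2" pi] by simp
  then have "\<Delta> * exp ((- pi + pi * (rw\<^sup>2 / re\<^sup>2) + R\<^sup>2 / re\<^sup>2) / 2) \<le> \<Delta> * exp (1 / 2)"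
    using \<open>\<Delta> > 0\<close> by (intro mult_left_mono) (simp_all only: exp_le_cancel_iff divide_right_mono)
  with peaceman_PSS_equation_fixed_point[of \<Delta> R rw re] assms show ?thesis
    by linarith
qed

text \<open>The roots stay bounded, so the fixed point identity carries the vanishing of
  \<open>R\<^sup>2 / re\<^sup>2\<close> over to the roots themselves.\<close>

lemma peaceman_radius_PSS_tendsto:
  assumes "K > 0" "q \<noteq> 0" "rw > 0" "\<Delta> > 0"
  shows "((\<lambda>re. peaceman_radius_PSS K q rw re \<Delta>) \<longlongrightarrow> exp (- pi / 2) * \<Delta>) at_top"
proof -
  define R where "R = (\<lambda>re. peaceman_radius_PSS K q rw re \<Delta>)"
  define M where "M = \<Delta> * exp (1 / 2)"
  have root: "\<forall>\<^sub>F re in at_top. rw < re \<and> 0 < R re \<and> R re \<le> re \<and>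
      peaceman_PSS_equation rw re \<Delta> (R re)"
    using eventually_gt_at_top[of rw] eventually_peaceman_PSS_applicable[OF assms(3,4)]
  proof eventually_elim
    case (elim re)
    with peaceman_radius_PSS_satisfies[OF assms, of re] show ?case
      by (simp add: R_def)
  qed
  have inv_sq: "((\<lambda>re. a / re\<^sup>2) \<longlongrightarrow> 0) at_top" for a :: real
    by (intro tendsto_divide_0[OF tendsto_const] filterlim_at_top_imp_at_infinity
        filterlim_pow_at_top filterlim_ident) simp
  have bound: "\<forall>\<^sub>F re in at_top. norm ((R re)\<^sup>2 / re\<^sup>2) \<le> M\<^sup>2 / re\<^sup>2"
    using root
  proof eventually_elim
    case (elim re)
    then have "R re \<le> M"
      using peaceman_PSS_root_le[of rw re \<Delta> "R re"] assms by (simp add: M_def)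
    then have "(R re)\<^sup>2 \<le> M\<^sup>2"
      using elim by (intro power_mono) auto
    then show ?case
      by (simp add: divide_right_mono)
  qed
  have "((\<lambda>re. (R re)\<^sup>2 / re\<^sup>2) \<longlongrightarrow> 0) at_top"
    by (rule Lim_null_comparison[OF bound inv_sq])
  then have "((\<lambda>re. \<Delta> * exp ((- pi + pi * (rw\<^sup>2 / re\<^sup>2) + (R re)\<^sup>2 / re\<^sup>2) / 2)) \<longlongrightarrow>
      \<Delta> * exp ((- pi + pi * 0 + 0) / 2)) at_top"
    by (intro tendsto_intros inv_sq) auto
  moreover have "\<forall>\<^sub>F re in at_top.
      \<Delta> * exp ((- pi + pi * (rw\<^sup>2 / re\<^sup>2) + (R re)\<^sup>2 / re\<^sup>2) / 2) = R re"
    using root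
    by eventually_elim (use peaceman_PSS_equation_fixed_point[OF \<open>\<Delta> > 0\<close>] in simp)
  ultimately have "(R \<longlongrightarrow> \<Delta> * exp ((- pi + pi * 0 + 0) / 2)) at_top"
    by (rule Lim_transform_eventually)
  then show ?thesis
    by (simp add: R_def mult.commute)
qed

section \<open>Comparison with the steady state\<close>

lemma is_peaceman_radius_SS_iff:
  assumes "\<Delta> > 0"
  shows "is_peaceman_radius_SS \<Delta> R \<longleftrightarrow> R = exp (- pi / 2) * \<Delta>"
proof
  assume R: "is_peaceman_radius_SS \<Delta> R"
  then have "ln R = - pi / 2 + ln \<Delta>"
    using assms by (auto simp: is_peaceman_radius_SS_def ln_div)
  then have "exp (ln R) = exp (- pi / 2 + ln \<Delta>)"
    by (simp only:)
  then show "R = exp (- pi / 2) * \<Delta>"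
    unfolding exp_add using R assms by (simp add: is_peaceman_radius_SS_def)
next
  assume "R = exp (- pi / 2) * \<Delta>"
  then show "is_peaceman_radius_SS \<Delta> R"
    using assms by (simp add: is_peaceman_radius_SS_def ln_div ln_mult)
qed

lemma peaceman_radius_SS_eq: "\<Delta> > 0 \<Longrightarrow> peaceman_radius_SS \<Delta> = exp (- pi / 2) * \<Delta>"
  by (simp add: peaceman_radius_SS_def is_peaceman_radius_SS_iff)

theorem theorem6:
  fixes K q rw \<Delta> :: real
  assumes "K > 0" and "q \<noteq> 0" and "rw > 0" and "\<Delta> > 0"
  shows "(\<forall>re>rw. pss_profile_problem K q rw re (pss_profile K q rw re)) \<and>
    (\<forall>re>rw. \<forall>R>0.
       peaceman_PSS_solution K q rw re \<Delta> R \<longleftrightarrow> peaceman_PSS_equation rw re \<Delta> R) \<and>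
    (\<forall>re>rw. peaceman_PSS_applicable rw re \<Delta> \<longrightarrow>
       (\<exists>!R. is_peaceman_radius_PSS K q rw re \<Delta> R) \<and>
       is_peaceman_radius_PSS K q rw re \<Delta> (peaceman_radius_PSS K q rw re \<Delta>) \<and>
       peaceman_PSS_equation rw re \<Delta> (peaceman_radius_PSS K q rw re \<Delta>)) \<and>
    (\<forall>\<^sub>F re in at_top. peaceman_PSS_applicable rw re \<Delta>) \<and>
    ((\<lambda>re. peaceman_radius_PSS K q rw re \<Delta>) \<longlongrightarrow> peaceman_radius_SS \<Delta>) at_top \<and>
    is_peaceman_radius_SS \<Delta> (peaceman_radius_SS \<Delta>) \<and>
    peaceman_radius_SS \<Delta> = exp (- pi / 2) * \<Delta>"
proof (intro conjI)
  show "\<forall>re>rw. pss_profile_problem K q rw re (pss_profile K q rw re)"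
    using pss_profile_solves_problem assms by blast
  show "\<forall>re>rw. \<forall>R>0.
      peaceman_PSS_solution K q rw re \<Delta> R \<longleftrightarrow> peaceman_PSS_equation rw re \<Delta> R"
    using peaceman_PSS_solution_iff_equation assms by blast
  show "\<forall>re>rw. peaceman_PSS_applicable rw re \<Delta> \<longrightarrow>
      (\<exists>!R. is_peaceman_radius_PSS K q rw re \<Delta> R) \<and>
      is_peaceman_radius_PSS K q rw re \<Delta> (peaceman_radius_PSS K q rw re \<Delta>) \<and>
      peaceman_PSS_equation rw re \<Delta> (peaceman_radius_PSS K q rw re \<Delta>)"
    by (intro allI impI conjI ex1_peaceman_radius_PSS[OF assms]
        peaceman_radius_PSS_satisfies(1,4)[OF assms])
  show "\<forall>\<^sub>F re in at_top. peaceman_PSS_applicable rw re \<Delta>"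
    using assms by (intro eventually_peaceman_PSS_applicable)
  show "((\<lambda>re. peaceman_radius_PSS K q rw re \<Delta>) \<longlongrightarrow> peaceman_radius_SS \<Delta>) at_top"
    using peaceman_radius_PSS_tendsto[OF assms] assms by (simp add: peaceman_radius_SS_eq)
  show "is_peaceman_radius_SS \<Delta> (peaceman_radius_SS \<Delta>)"
    using assms by (simp add: is_peaceman_radius_SS_iff peaceman_radius_SS_eq)
  show "peaceman_radius_SS \<Delta> = exp (- pi / 2) * \<Delta>"
    using assms by (intro peaceman_radius_SS_eq)
qed

end
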